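(* Let $\alpha>0$ and $0<p,q\le\infty$. Then for every entire function $f$: if $0<q<\infty$, $$\|f\|_{\mathcal F_\alpha^{p,q}}^q\ \asymp\ \sum_{k=0}^\infty(1+k)\,B_p(f;k)^q,$$ with implicit constants depending only on $\alpha$ and $q$ (either side may be infinite), and if $q=\infty$, $$\|f\|_{\mathcal F_\alpha^{p,\infty}}=\sup_{k\ge0}B_p(f;k).$$
   Context: For an entire function $f$ and $r\ge0$, $M_p(f,r):=\left(\frac1{2\pi}\int_0^{2\pi}|f(re^{i\theta})|^p\,d\theta\right)^{1/p}$ for $0<p<\infty$, and $M_\infty(f,r):=\sup_{\theta\in[0,2\pi]}|f(re^{i\theta})|$. Put $$\|f\|_{\mathcal F_\alpha^{p,q}}:=\left(\int_0^\infty M_p(f,r)^q\,\alpha q\,e^{-\frac{\alpha q}{2}r^2}r\,dr\right)^{1/q}\ (0<q<\infty),\qquad \|f\|_{\mathcal F_\alpha^{p,\infty}}:=\sup_{r\ge0}M_p(f,r)e^{-\frac{\alpha}{2}r^2}.$$ For $k\in\{0,1,2,\dots\}$, $B_p(f;k):=\sup_{r\in[k,k+1)}M_p(f,r)e^{-\frac\alpha2r^2}$. $X\asymp Y$ means $C^{-1}Y\le X\le CY$ with a constant $C$ independent of $f$. *)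

theory Defs
  imports "HOL-Analysis.Analysis"
begin

text \<open>
  Real powers of extended nonnegative reals, used only for exponents \<open>a > 0\<close>, so that
  \<open>0\<close> is sent to \<open>0\<close> and \<open>\<infinity>\<close> to \<open>\<infinity>\<close>.
\<close>

definition epowr :: "ennreal \<Rightarrow> real \<Rightarrow> ennreal" where
  "epowr x a = (if x = \<infinity> then \<infinity> else ennreal (enn2real x powr a))"

text \<open>
  The indices \<open>p\<close>, \<open>q\<close> range over \<open>(0, \<infinity>]\<close> inside \<^typ>\<open>ennreal\<close>. For continuous \<open>f\<close> the
  integrand and the set of values below are bounded, so the integral mean is a genuine real number.
\<close>

definition integral_mean :: "ennreal \<Rightarrow> (complex \<Rightarrow> complex) \<Rightarrow> real \<Rightarrow> real" where
  "integral_mean p f r =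
     (if p = \<infinity> then (SUP \<theta>\<in>{0..2*pi}. cmod (f (of_real r * cis \<theta>)))
      else (1 / (2*pi) * (LBINT \<theta>:{0..2*pi}. cmod (f (of_real r * cis \<theta>)) powr enn2real p))
             powr (1 / enn2real p))"

text \<open>The norm may be infinite, hence takes values in \<^typ>\<open>ennreal\<close>.\<close>

definition fock_norm :: "real \<Rightarrow> ennreal \<Rightarrow> ennreal \<Rightarrow> (complex \<Rightarrow> complex) \<Rightarrow> ennreal" where
  "fock_norm \<alpha> p q f =
     (if q = \<infinity> then (SUP r\<in>{0..}. ennreal (integral_mean p f r * exp (- (\<alpha> / 2) * r\<^sup>2)))
      else epowr
        (\<integral>\<^sup>+ r\<in>{0..}. ennreal (integral_mean p f r powr enn2real q * \<alpha> * enn2real q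
             * exp (- (\<alpha> * enn2real q / 2) * r\<^sup>2) * r) \<partial>lborel)
        (1 / enn2real q))"

definition block_sup :: "real \<Rightarrow> ennreal \<Rightarrow> (complex \<Rightarrow> complex) \<Rightarrow> nat \<Rightarrow> ennreal" where
  "block_sup \<alpha> p f k =
     (SUP r\<in>{real k..<real k + 1}. ennreal (integral_mean p f r * exp (- (\<alpha> / 2) * r\<^sup>2)))"

end

theory Submission
  imports Defs "HOL-Complex_Analysis.Complex_Analysis"
begin

text \<open>
  Write \<open>M r\<close> for the integral mean. For every real \<open>l\<close> the function \<open>r\<^sup>l M r\<close> is bounded on an
  interval by its values at the end points (a form of Hardy's convexity theorem): for \<open>p = \<infinity>\<close> this is
  the maximum principle for \<open>G s = e\<^sup>l\<^sup>s f (e\<^sup>s)\<close> on a vertical strip, and for finite \<open>p\<close> the integral of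
  the subharmonic function \<open>(|G|\<^sup>2 + \<epsilon>) powr (p/2)\<close> over one period of the imaginary direction
  is convex in the real direction, after which \<open>\<epsilon>\<close> tends to \<open>0\<close>.

  The choice \<open>l = - \<alpha> r0\<^sup>2\<close> makes \<open>r0\<close> a critical point of \<open>r powr (- l) * exp (- \<alpha> r\<^sup>2 / 2)\<close>, which
  therefore changes only by a bounded factor at distance at most \<open>1/2\<close> from \<open>r0\<close>. Hence
  \<open>M r exp (- \<alpha> r\<^sup>2 / 2)\<close> is comparable from below to its value at \<open>r0\<close> on an interval of length
  \<open>1/2\<close> either to the left or to the right of \<open>r0\<close>, with a constant that depends neither on \<open>r0\<close>
  nor on \<open>p\<close>. Monotonicity of \<open>M\<close> alone would lose a factor growing with \<open>r0\<close>.
\<close>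

section \<open>Convexity of the period integrals of a regularized power of |G|\<close>

lemma has_real_derivative_Re_Im_Complex:
  assumes "(H has_field_derivative D) (at (Complex t \<theta>))"
  shows "((\<lambda>t. Re (H (Complex t \<theta>))) has_real_derivative Re D) (at t)"
    and "((\<lambda>t. Im (H (Complex t \<theta>))) has_real_derivative Im D) (at t)"
    and "((\<lambda>\<theta>. Re (H (Complex t \<theta>))) has_real_derivative - Im D) (at \<theta>)"
    and "((\<lambda>\<theta>. Im (H (Complex t \<theta>))) has_real_derivative Re D) (at \<theta>)"
proof -
  have "((\<lambda>t. Complex t \<theta>) has_vector_derivative 1) (at t)"
    unfolding Complex_eq by (auto intro!: derivative_eq_intros)
  from field_vector_diff_chain_at[OF this assms]
  have t: "((\<lambda>t. H (Complex t \<theta>)) has_vector_derivative D) (at t)"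
    by (simp add: o_def)
  \<comment> \<open>Moving in the direction \<open>\<i>\<close> multiplies \<open>D\<close> by
    \<open>\<i>\<close>; this produces the Cauchy-Riemann signs of the last two claims.\<close>
  have "((\<lambda>\<theta>. Complex t \<theta>) has_vector_derivative \<i>) (at \<theta>)"
    unfolding Complex_eq by (auto intro!: derivative_eq_intros)
  from field_vector_diff_chain_at[OF this assms]
  have \<theta>: "((\<lambda>\<theta>. H (Complex t \<theta>)) has_vector_derivative \<i> * D) (at \<theta>)"
    by (simp add: o_def)
  show "((\<lambda>t. Re (H (Complex t \<theta>))) has_real_derivative Re D) (at t)"
    and "((\<lambda>t. Im (H (Complex t \<theta>))) has_real_derivative Im D) (at t)"
    and "((\<lambda>\<theta>. Re (H (Complex t \<theta>))) has_real_derivative - Im D) (at \<theta>)"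
    and "((\<lambda>\<theta>. Im (H (Complex t \<theta>))) has_real_derivative Re D) (at \<theta>)"
    using bounded_linear.has_vector_derivative[OF bounded_linear_Re t]
      bounded_linear.has_vector_derivative[OF bounded_linear_Im t]
      bounded_linear.has_vector_derivative[OF bounded_linear_Re \<theta>]
      bounded_linear.has_vector_derivative[OF bounded_linear_Im \<theta>]
    by (simp_all add: has_real_derivative_iff_has_vector_derivative)
qed

text \<open>The second derivative of the integral is the integral of the Laplacian, because the
  second \<theta>-derivative integrates to 0 over a period. Adding \<epsilon> keeps the base
  positive, so the power is smooth even at zeros of \<open>G\<close> and for \<open>a < 1\<close>. A
  unimodular factor \<open>c\<close> is allowed because only |G| and \<open>cnj G * G'\<close>
  enter.\<close>

lemma convex_on_integral_regularized_powr:
  fixes G :: "complex \<Rightarrow> complex" and a \<epsilon> :: real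
  assumes holG: "G holomorphic_on UNIV" and "a > 0" "\<epsilon> > 0"
    and per: "\<And>z. G (z + 2 * of_real pi * \<i>) = c * G z" and "cmod c = 1"
  shows "convex_on UNIV
           (\<lambda>t. integral (cbox 0 (2*pi)) (\<lambda>\<theta>. ((cmod (G (Complex t \<theta>)))\<^sup>2 + \<epsilon>) powr a))"
proof -
  define G1 where "G1 = deriv G"
  define G2 where "G2 = deriv G1"
  have holG1: "G1 holomorphic_on UNIV"
    unfolding G1_def using holG by (intro holomorphic_deriv) auto
  have holG2: "G2 holomorphic_on UNIV"
    unfolding G2_def using holG1 by (intro holomorphic_deriv) auto
  have dG: "(G has_field_derivative G1 z) (at z)" for z
    unfolding G1_def using holG by (auto intro: holomorphic_derivI[of G UNIV])
  have dG1: "(G1 has_field_derivative G2 z) (at z)" for z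
    unfolding G2_def using holG1 by (auto intro: holomorphic_derivI[of G1 UNIV])
  have per1: "G1 (z + 2 * of_real pi * \<i>) = c * G1 z" for z
  proof -
    have "((\<lambda>z. G (z + 2 * of_real pi * \<i>)) has_field_derivative G1 (z + 2 * of_real pi * \<i>)) (at z)"
      using dG DERIV_shift by blast
    moreover have "((\<lambda>z. c * G z) has_field_derivative c * G1 z) (at z)"
      using dG by (auto intro!: derivative_eq_intros)
    ultimately show ?thesis
      unfolding per using DERIV_unique by blast
  qed
  define X Y X1 Y1 X2 Y2 where
    "X = (\<lambda>t \<theta>. Re (G (Complex t \<theta>)))" and "Y = (\<lambda>t \<theta>. Im (G (Complex t \<theta>)))" and
    "X1 = (\<lambda>t \<theta>. Re (G1 (Complex t \<theta>)))" and "Y1 = (\<lambda>t \<theta>. Im (G1 (Complex t \<theta>)))" and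
    "X2 = (\<lambda>t \<theta>. Re (G2 (Complex t \<theta>)))" and "Y2 = (\<lambda>t \<theta>. Im (G2 (Complex t \<theta>)))"
  note XY = X_def Y_def X1_def Y1_def X2_def Y2_def
  have contC: "continuous_on UNIV (\<lambda>z::real \<times> real. H (Complex (fst z) (snd z)))"
    if "H holomorphic_on UNIV" for H
  proof (rule continuous_on_compose2[of UNIV H])
    show "continuous_on UNIV H" using that holomorphic_on_imp_continuous_on by blast
    show "continuous_on UNIV (\<lambda>z::real \<times> real. Complex (fst z) (snd z))"
      unfolding Complex_eq by (intro continuous_intros)
  qed auto
  note cont2 = continuous_on_Re[OF contC[OF holG]] continuous_on_Im[OF contC[OF holG]]
    continuous_on_Re[OF contC[OF holG1]] continuous_on_Im[OF contC[OF holG1]]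
    continuous_on_Re[OF contC[OF holG2]] continuous_on_Im[OF contC[OF holG2]]
  have cont: "continuous_on UNIV (\<lambda>z. X (fst z) (snd z))" "continuous_on UNIV (\<lambda>z. Y (fst z) (snd z))"
    "continuous_on UNIV (\<lambda>z. X1 (fst z) (snd z))" "continuous_on UNIV (\<lambda>z. Y1 (fst z) (snd z))"
    "continuous_on UNIV (\<lambda>z. X2 (fst z) (snd z))" "continuous_on UNIV (\<lambda>z. Y2 (fst z) (snd z))"
    unfolding XY by (fact cont2)+
  have ders:
    "((\<lambda>t. X t \<theta>) has_real_derivative X1 t \<theta>) (at t)"
    "((\<lambda>t. Y t \<theta>) has_real_derivative Y1 t \<theta>) (at t)"
    "((\<lambda>\<theta>. X t \<theta>) has_real_derivative - Y1 t \<theta>) (at \<theta>)"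
    "((\<lambda>\<theta>. Y t \<theta>) has_real_derivative X1 t \<theta>) (at \<theta>)"
    "((\<lambda>t. X1 t \<theta>) has_real_derivative X2 t \<theta>) (at t)"
    "((\<lambda>t. Y1 t \<theta>) has_real_derivative Y2 t \<theta>) (at t)"
    "((\<lambda>\<theta>. X1 t \<theta>) has_real_derivative - Y2 t \<theta>) (at \<theta>)"
    "((\<lambda>\<theta>. Y1 t \<theta>) has_real_derivative X2 t \<theta>) (at \<theta>)" for t \<theta>
    unfolding XY by (fact has_real_derivative_Re_Im_Complex[OF dG]
      has_real_derivative_Re_Im_Complex[OF dG1])+
  define w where "w = (\<lambda>t \<theta>. (X t \<theta>)\<^sup>2 + (Y t \<theta>)\<^sup>2 + \<epsilon>)"
  have w_pos: "w t \<theta> > 0" for t \<theta>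
    using \<open>\<epsilon> > 0\<close> by (auto simp: w_def intro: add_nonneg_pos)
  \<comment> \<open>By Cauchy-Riemann, the first derivatives \<open>A\<close> and \<open>B\<close>
    of \<open>w\<close> are twice the real part and minus twice the imaginary part of
    \<open>cnj G * G1\<close>; \<open>At\<close> and \<open>B\<theta>\<close> are its pure second
    derivatives. The functions \<open>ut\<close>, \<open>u\<theta>\<close>, \<open>utt\<close>,
    \<open>u\<theta>\<theta>\<close> are the corresponding derivatives of
    \<open>w powr a\<close>.\<close>
  define A where "A = (\<lambda>t \<theta>. 2 * (X t \<theta> * X1 t \<theta> + Y t \<theta> * Y1 t \<theta>))"
  define B where "B = (\<lambda>t \<theta>. 2 * (Y t \<theta> * X1 t \<theta> - X t \<theta> * Y1 t \<theta>))"
  define At where "At = (\<lambda>t \<theta>. 2 * ((X1 t \<theta>)\<^sup>2 + (Y1 t \<theta>)\<^sup>2 + X t \<theta> * X2 t \<theta> + Y t \<theta> * Y2 t \<theta>))"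
  define B\<theta> where "B\<theta> = (\<lambda>t \<theta>. 2 * ((X1 t \<theta>)\<^sup>2 + (Y1 t \<theta>)\<^sup>2 - X t \<theta> * X2 t \<theta> - Y t \<theta> * Y2 t \<theta>))"
  define ut where "ut = (\<lambda>t \<theta>. a * w t \<theta> powr (a - 1) * A t \<theta>)"
  define u\<theta> where "u\<theta> = (\<lambda>t \<theta>. a * w t \<theta> powr (a - 1) * B t \<theta>)"
  define utt where "utt = (\<lambda>t \<theta>. a * ((a - 1) * w t \<theta> powr (a - 2) * (A t \<theta>)\<^sup>2 + w t \<theta> powr (a - 1) * At t \<theta>))"
  define u\<theta>\<theta> where "u\<theta>\<theta> = (\<lambda>t \<theta>. a * ((a - 1) * w t \<theta> powr (a - 2) * (B t \<theta>)\<^sup>2 + w t \<theta> powr (a - 1) * B\<theta> t \<theta>))"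
  have dw: "((\<lambda>t. w t \<theta>) has_real_derivative A t \<theta>) (at t)"
    "((\<lambda>\<theta>. w t \<theta>) has_real_derivative B t \<theta>) (at \<theta>)"
    "((\<lambda>t. A t \<theta>) has_real_derivative At t \<theta>) (at t)"
    "((\<lambda>\<theta>. B t \<theta>) has_real_derivative B\<theta> t \<theta>) (at \<theta>)" for t \<theta>
    unfolding w_def A_def B_def At_def B\<theta>_def
    by (rule derivative_eq_intros ders refl | simp add: algebra_simps power2_eq_square)+
  have dwp: "((\<lambda>t. w t \<theta> powr b) has_real_derivative b * w t \<theta> powr (b - 1) * A t \<theta>) (at t)"
    "((\<lambda>\<theta>. w t \<theta> powr b) has_real_derivative b * w t \<theta> powr (b - 1) * B t \<theta>) (at \<theta>)" for t \<theta> b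
    using DERIV_fun_powr[OF dw(1) w_pos] DERIV_fun_powr[OF dw(2) w_pos] by simp_all
  have du: "((\<lambda>t. ut t \<theta>) has_real_derivative utt t \<theta>) (at t)"
    "((\<lambda>\<theta>. u\<theta> t \<theta>) has_real_derivative u\<theta>\<theta> t \<theta>) (at \<theta>)" for t \<theta>
    unfolding ut_def u\<theta>_def utt_def u\<theta>\<theta>_def
    by (rule derivative_eq_intros dw dwp refl | simp add: algebra_simps power2_eq_square)+
  have cw: "continuous_on UNIV (\<lambda>z. w (fst z) (snd z) powr b)" for b
    using w_pos unfolding w_def by (intro continuous_intros cont) (simp add: less_imp_neq[symmetric])
  have cA: "continuous_on UNIV (\<lambda>z. A (fst z) (snd z))" "continuous_on UNIV (\<lambda>z. At (fst z) (snd z))"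
     "continuous_on UNIV (\<lambda>z. B (fst z) (snd z))" "continuous_on UNIV (\<lambda>z. B\<theta> (fst z) (snd z))"
    unfolding A_def At_def B_def B\<theta>_def by (intro continuous_intros cont)+
  have cut: "continuous_on UNIV (\<lambda>z. ut (fst z) (snd z))" and cutt: "continuous_on UNIV (\<lambda>z. utt (fst z) (snd z))"
    and cu\<theta>: "continuous_on UNIV (\<lambda>z. u\<theta>\<theta> (fst z) (snd z))"
    unfolding ut_def utt_def u\<theta>\<theta>_def by (intro continuous_intros cw cA)+
  have slice: "continuous_on S (g t)" if "continuous_on UNIV (\<lambda>z. g (fst z) (snd z))"
    for g :: "real \<Rightarrow> real \<Rightarrow> real" and t S
    using continuous_on_compose2[OF that, of S "\<lambda>\<theta>. (t, \<theta>)"] by (simp add: continuous_on_Pair)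
  have intg: "g t integrable_on cbox 0 (2*pi)" if "continuous_on UNIV (\<lambda>z. g (fst z) (snd z))"
    for g :: "real \<Rightarrow> real \<Rightarrow> real" and t
    using slice[OF that] by (rule integrable_continuous)
  have int\<theta>\<theta>: "(u\<theta>\<theta> t has_integral 0) {0..2*pi}" for t
  proof -
    have "(u\<theta>\<theta> t has_integral (u\<theta> t (2*pi) - u\<theta> t 0)) {0..2*pi}"
      by (rule fundamental_theorem_of_calculus)
        (auto intro!: has_field_derivative_at_within[OF du(2)]
          simp: has_real_derivative_iff_has_vector_derivative[symmetric])
    \<comment> \<open>\<open>G\<close> and \<open>G1\<close> both pick up the factor
      \<open>c\<close> over a period, and it cancels in |G| and in
      \<open>cnj G * G1\<close>.\<close>
    moreover have "u\<theta> t (2*pi) = u\<theta> t 0"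
    proof -
      have e: "Complex t (2*pi) = Complex t 0 + 2 * of_real pi * \<i>" by (simp add: complex_eq_iff)
      have c1: "(Re c)\<^sup>2 + (Im c)\<^sup>2 = 1"
        using \<open>cmod c = 1\<close> by (simp add: cmod_def)
      have wB: "w t \<theta> = (cmod (G (Complex t \<theta>)))\<^sup>2 + \<epsilon>"
        "B t \<theta> = - 2 * Im (cnj (G (Complex t \<theta>)) * G1 (Complex t \<theta>))" for \<theta>
        by (simp_all add: w_def B_def XY cmod_power2 algebra_simps)
      have "cnj (c * z) * (c * z') = cnj z * z'" for z z'
      proof -
        have "cnj (c * z) * (c * z') = (c * cnj c) * (cnj z * z')" by (simp add: ac_simps)
        also have "c * cnj c = 1" by (simp only: complex_mult_cnj c1 of_real_1)
        finally show ?thesis by simp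
      qed
      then have "B t (2*pi) = B t 0" unfolding wB e per per1 by (simp only:)
      moreover have "w t (2*pi) = w t 0"
        unfolding wB e per by (simp add: norm_mult \<open>cmod c = 1\<close>)
      ultimately show ?thesis by (simp add: u\<theta>_def)
    qed
    ultimately show ?thesis by simp
  qed
  \<comment> \<open>the Laplacian of \<open>w powr a\<close>; its second part integrates to \<open>0\<close> by periodicity\<close>
  have lap: "utt t \<theta> + u\<theta>\<theta> t \<theta> \<ge> 0" for t \<theta>
  proof -
    \<comment> \<open>With \<open>D\<close> = |G'|^2, the squared gradient of \<open>w\<close> is 4
      |G|^2 \<open>D\<close> and the Laplacian of \<open>w\<close> is 4 \<open>D\<close>.\<close>
    define D where "D = (X1 t \<theta>)\<^sup>2 + (Y1 t \<theta>)\<^sup>2"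
    have "(A t \<theta>)\<^sup>2 + (B t \<theta>)\<^sup>2 = 4 * (w t \<theta> - \<epsilon>) * D"
      by (simp add: A_def B_def w_def D_def power2_eq_square algebra_simps)
    moreover have "At t \<theta> + B\<theta> t \<theta> = 4 * D"
      by (simp add: At_def B\<theta>_def D_def)
    moreover have "w t \<theta> powr (a - 1) = w t \<theta> powr (a - 2) * w t \<theta>"
      using powr_mult_base[of "w t \<theta>" "a - 2"] w_pos[of t \<theta>] by (simp add: mult.commute)
    moreover have "utt t \<theta> + u\<theta>\<theta> t \<theta>
        = a * ((a - 1) * w t \<theta> powr (a - 2) * ((A t \<theta>)\<^sup>2 + (B t \<theta>)\<^sup>2)
              + w t \<theta> powr (a - 1) * (At t \<theta> + B\<theta> t \<theta>))"
      unfolding utt_def u\<theta>\<theta>_def by (simp add: distrib_left)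
    ultimately have "utt t \<theta> + u\<theta>\<theta> t \<theta>
        = a * ((a - 1) * w t \<theta> powr (a - 2) * (4 * (w t \<theta> - \<epsilon>) * D)
              + w t \<theta> powr (a - 2) * w t \<theta> * (4 * D))"
      by (simp only:)
    \<comment> \<open>The term with \<open>a - 1\<close>, negative for small \<open>a\<close>, is
      absorbed: (a - 1)(w - \<epsilon>) + w = a(w - \<epsilon>) + \<epsilon>, where w - \<epsilon> =
      |G|^2. This covers every positive exponent.\<close>
    also have "\<dots> = 4 * a * w t \<theta> powr (a - 2) * D * (a * (w t \<theta> - \<epsilon>) + \<epsilon>)"
      by (simp add: algebra_simps)
    also have "\<dots> \<ge> 0"
      using \<open>a > 0\<close> \<open>\<epsilon> > 0\<close> by (intro mult_nonneg_nonneg add_nonneg_nonneg) (auto simp: D_def w_def)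
    finally show ?thesis .
  qed
  have "convex_on UNIV (\<lambda>t. integral (cbox 0 (2*pi)) (\<lambda>\<theta>. w t \<theta> powr a))"
  proof (rule f''_ge0_imp_convex)
    show "((\<lambda>t. integral (cbox 0 (2*pi)) (\<lambda>\<theta>. w t \<theta> powr a)) has_real_derivative
            integral (cbox 0 (2*pi)) (ut t)) (at t)" for t
    proof (rule leibniz_rule_field_derivative[where U = UNIV, simplified])
      show "((\<lambda>x. w x \<theta> powr a) has_real_derivative ut x \<theta>) (at x)" for x \<theta>
        using dwp(1) by (simp add: ut_def)
      show "(\<lambda>\<theta>. w x \<theta> powr a) integrable_on cbox 0 (2*pi)" for x
        by (rule intg[OF cw])
      show "continuous_on (UNIV \<times> cbox 0 (2*pi)) (\<lambda>(x, y). ut x y)"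
        using cut by (auto simp: case_prod_beta intro: continuous_on_subset)
    qed
    show "((\<lambda>t. integral (cbox 0 (2*pi)) (ut t)) has_real_derivative
            integral (cbox 0 (2*pi)) (utt t)) (at t)" for t
    proof (rule leibniz_rule_field_derivative[where U = UNIV, simplified])
      show "((\<lambda>x. ut x \<theta>) has_real_derivative utt x \<theta>) (at x)" for x \<theta>
        by (rule du)
      show "ut x integrable_on cbox 0 (2*pi)" for x
        by (rule intg[OF cut])
      show "continuous_on (UNIV \<times> cbox 0 (2*pi)) (\<lambda>(x, y). utt x y)"
        using cutt by (auto simp: case_prod_beta intro: continuous_on_subset)
    qed
    show "0 \<le> integral (cbox 0 (2*pi)) (utt t)" for t
    proof -
      have "0 \<le> integral (cbox 0 (2*pi)) (\<lambda>\<theta>. utt t \<theta> + u\<theta>\<theta> t \<theta>)"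
        using lap by (intro integral_nonneg integrable_add intg cutt cu\<theta>)
      also have "\<dots> = integral (cbox 0 (2*pi)) (utt t) + integral (cbox 0 (2*pi)) (u\<theta>\<theta> t)"
        by (intro integral_add intg cutt cu\<theta>)
      also have "integral (cbox 0 (2*pi)) (u\<theta>\<theta> t) = 0"
        using int\<theta>\<theta> by (simp add: integral_unique)
      finally show ?thesis by simp
    qed
  qed auto
  then show ?thesis
    by (simp add: w_def XY cmod_power2)
qed

section \<open>Logarithmic coordinates and circle integrals\<close>

lemma norm_mult_comp_exp_Complex:
  "cmod (exp (of_real l * Complex t \<theta>) * f (exp (Complex t \<theta>))) =
     exp t powr l * cmod (f (of_real (exp t) * cis \<theta>))"
  by (simp add: norm_mult exp_eq_polar powr_def)

text \<open>For non-integer \<open>l\<close> the function is not periodic, but the factor has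
  modulus 1, which is what the convexity of the period integrals requires.\<close>

lemma comp_exp_quasiperiodic:
  fixes l :: real and f :: "complex \<Rightarrow> complex"
  defines "G \<equiv> \<lambda>s. exp (of_real l * s) * f (exp s)"
  shows "G (z + 2 * of_real pi * \<i>) = cis (2 * pi * l) * G z"
proof -
  have "exp (z + 2 * of_real pi * \<i>) = exp z"
    by (simp add: exp_add exp_two_pi_i)
  moreover have "exp (of_real l * (z + 2 * of_real pi * \<i>)) = cis (2 * pi * l) * exp (of_real l * z)"
    by (simp add: cis_conv_exp algebra_simps flip: exp_add)
  ultimately show ?thesis by (simp add: G_def)
qed

lemma comp_exp_holomorphic:
  assumes "f holomorphic_on UNIV"
  shows "(\<lambda>s. exp (of_real l * s) * f (exp s)) holomorphic_on UNIV"
  using holomorphic_on_compose[of exp UNIV f] assms holomorphic_on_subset[OF assms]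
  by (auto intro!: holomorphic_intros simp: o_def)

text \<open>The regularized integrals \<open>J \<epsilon>\<close> are convex in t = ln r, hence at
  most the larger of their end point values; this bound survives the limit \<epsilon> to 0, where
  \<open>J 0 (ln x)\<close> is the weighted circle integral.\<close>

lemma circle_powr_integral_quasiconvex:
  fixes f :: "complex \<Rightarrow> complex" and P l :: real
  defines "I \<equiv> \<lambda>r. integral (cbox 0 (2*pi)) (\<lambda>\<theta>. cmod (f (of_real r * cis \<theta>)) powr P)"
  assumes holf: "f holomorphic_on UNIV" and "P > 0" and r: "0 < r1" "r1 \<le> r" "r \<le> r2"
  shows "r powr (l * P) * I r \<le> max (r1 powr (l * P) * I r1) (r2 powr (l * P) * I r2)"
proof -
  define G where "G = (\<lambda>s. exp (of_real l * s) * f (exp s))"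
  define J where "J = (\<lambda>\<epsilon> t. integral (cbox 0 (2*pi)) (\<lambda>\<theta>. ((cmod (G (Complex t \<theta>)))\<^sup>2 + \<epsilon>) powr (P/2)))"
  have holG: "G holomorphic_on UNIV"
    unfolding G_def using holf by (rule comp_exp_holomorphic)
  have J0: "J 0 (ln x) = x powr (l * P) * I x" if "x > 0" for x
  proof -
    have "((cmod (G (Complex (ln x) \<theta>)))\<^sup>2) powr (P/2) = x powr (l * P) * cmod (f (of_real x * cis \<theta>)) powr P" for \<theta>
    proof -
      have "((cmod (G (Complex (ln x) \<theta>)))\<^sup>2) powr (P/2) = cmod (G (Complex (ln x) \<theta>)) powr P"
        by (simp add: powr_powr flip: powr_numeral)
      also have "\<dots> = (x powr l * cmod (f (of_real x * cis \<theta>))) powr P"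
        unfolding G_def norm_mult_comp_exp_Complex using that by simp
      finally show ?thesis by (simp add: powr_mult powr_powr)
    qed
    then show ?thesis by (simp add: J_def I_def)
  qed
  have lim: "((\<lambda>\<epsilon>. J \<epsilon> t) \<longlongrightarrow> J 0 t) (at_right 0)" for t
  proof -
    have "continuous_on UNIV (\<lambda>z::real \<times> real. G (Complex t (snd z)))"
      unfolding Complex_eq
      by (rule continuous_on_compose2[OF holomorphic_on_imp_continuous_on[OF holG]])
        (auto intro!: continuous_intros)
    \<comment> \<open>The exponent \<open>P/2\<close> is positive, so the power is continuous down
      to base 0 and zeros of \<open>G\<close> are harmless at \<epsilon> = 0. Joint continuity on a
      compact rectangle then passes to the integral.\<close>
    then have "continuous_on ({0..1} \<times> cbox 0 (2*pi))
        (\<lambda>(\<epsilon>, \<theta>). ((cmod (G (Complex t \<theta>)))\<^sup>2 + \<epsilon>) powr (P/2))"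
      using \<open>P > 0\<close> unfolding case_prod_beta
      by (intro continuous_on_powr' continuous_intros) (auto intro: continuous_on_subset)
    then have "continuous_on {0..1} (\<lambda>\<epsilon>. J \<epsilon> t)"
      unfolding J_def by (rule integral_continuous_on_param)
    then have "((\<lambda>\<epsilon>. J \<epsilon> t) \<longlongrightarrow> J 0 t) (at 0 within {0..1})"
      by (simp add: continuous_on_def)
    moreover have "at 0 within {0..1::real} = at_right 0"
      by (rule at_within_Icc_at_right) simp
    ultimately show ?thesis by simp
  qed
  have "J \<epsilon> (ln r) \<le> max (J \<epsilon> (ln r1)) (J \<epsilon> (ln r2))" if "\<epsilon> > 0" for \<epsilon>
  proof -
    have "convex_on UNIV (J \<epsilon>)"
      unfolding J_def using holG that \<open>P > 0\<close>
      by (intro convex_on_integral_regularized_powr[where c = "cis (2 * pi * l)"])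
        (auto simp: G_def comp_exp_quasiperiodic)
    then have "convex_on {ln r1..ln r2} (J \<epsilon>)"
      by (rule convex_on_subset) auto
    then show ?thesis
      by (rule convex_on_le_max) (use r in auto)
  qed
  then have "eventually (\<lambda>\<epsilon>. J \<epsilon> (ln r) \<le> max (J \<epsilon> (ln r1)) (J \<epsilon> (ln r2))) (at_right 0)"
    by (auto simp: eventually_at_filter)
  then have "J 0 (ln r) \<le> max (J 0 (ln r1)) (J 0 (ln r2))"
    by (intro tendsto_le[OF _ tendsto_max[OF lim lim] lim]) auto
  then show ?thesis using r by (simp add: J0)
qed

section \<open>Integral means for finite and infinite p and their end point bound\<close>

lemma continuous_on_circle:
  assumes "f holomorphic_on UNIV"
  shows "continuous_on S (\<lambda>\<theta>. cmod (f (of_real r * cis \<theta>)))"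
  by (intro continuous_on_norm
      continuous_on_compose2[OF holomorphic_on_imp_continuous_on[OF assms]] continuous_intros) auto

lemma integral_mean_infinity:
  "integral_mean \<infinity> f r = (SUP \<theta>\<in>{0..2*pi}. cmod (f (of_real r * cis \<theta>)))"
  by (simp add: integral_mean_def)

lemma bdd_above_circle:
  assumes "f holomorphic_on UNIV"
  shows "bdd_above ((\<lambda>\<theta>. cmod (f (of_real r * cis \<theta>))) ` {0..2*pi})"
  using compact_continuous_image[OF continuous_on_circle[OF assms] compact_Icc]
  by (intro bounded_imp_bdd_above compact_imp_bounded)

lemma integral_mean_finite:
  assumes "f holomorphic_on UNIV" "p > 0" "p \<noteq> \<infinity>"
  shows "integral_mean p f r =
    (1 / (2*pi) * integral (cbox 0 (2*pi)) (\<lambda>\<theta>. cmod (f (of_real r * cis \<theta>)) powr enn2real p))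
      powr (1 / enn2real p)"
proof -
  have "enn2real p > 0"
    using assms by (simp add: enn2real_positive_iff less_top)
  then have "continuous_on {0..2*pi} (\<lambda>\<theta>. cmod (f (of_real r * cis \<theta>)) powr enn2real p)"
    by (intro continuous_on_powr' continuous_on_circle assms) auto
  then show ?thesis
    using assms
    by (simp add: integral_mean_def set_borel_integral_eq_integral(2) borel_integrable_atLeastAtMost')
qed

lemma circle_powr_integrable:
  assumes "f holomorphic_on UNIV" "P > 0"
  shows "(\<lambda>\<theta>. cmod (f (of_real r * cis \<theta>)) powr P) integrable_on cbox 0 (2*pi)"
  using assms(2) by (intro integrable_continuous continuous_on_powr' continuous_on_circle assms) auto

text \<open>Controls the means as the radius tends to 0, a point that the logarithmic coordinate
  does not reach.\<close>

lemma integral_mean_bounds: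
  assumes holf: "f holomorphic_on UNIV" and "p > 0" "a \<ge> 0"
    and ab: "\<And>\<theta>. a \<le> cmod (f (of_real r * cis \<theta>))" "\<And>\<theta>. cmod (f (of_real r * cis \<theta>)) \<le> b"
  shows "a \<le> integral_mean p f r" "integral_mean p f r \<le> b"
proof -
  have "a \<le> integral_mean p f r \<and> integral_mean p f r \<le> b"
  proof (cases "p = \<infinity>")
    case True
    have "a \<le> (SUP \<theta>\<in>{0..2*pi}. cmod (f (of_real r * cis \<theta>)))"
      using ab(1)[of 0] by (intro cSUP_upper2[where x = 0] bdd_above_circle holf) auto
    moreover have "(SUP \<theta>\<in>{0..2*pi}. cmod (f (of_real r * cis \<theta>))) \<le> b"
      using ab by (intro cSUP_least) auto
    ultimately show ?thesis unfolding True integral_mean_infinity by simp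
  next
    case False
    define P where "P = enn2real p"
    have "P > 0"
      using False \<open>p > 0\<close> by (simp add: P_def enn2real_positive_iff less_top)
    define I where "I = integral (cbox 0 (2*pi)) (\<lambda>\<theta>. cmod (f (of_real r * cis \<theta>)) powr P)"
    have "b \<ge> 0" using ab(2)[of 0] norm_ge_zero order_trans by blast
    have "integral (cbox 0 (2*pi)) (\<lambda>\<theta>. a powr P) \<le> I"
      unfolding I_def using ab(1) \<open>P > 0\<close> \<open>a \<ge> 0\<close>
      by (intro integral_le circle_powr_integrable holf integrable_const) (auto intro: powr_mono2)
    then have "a powr P \<le> 1 / (2*pi) * I"
      by (simp add: field_simps)
    then have 1: "(a powr P) powr (1 / P) \<le> (1 / (2*pi) * I) powr (1 / P)"
      using \<open>P > 0\<close> by (intro powr_mono2) auto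
    have "I \<ge> 0" unfolding I_def by (intro integral_nonneg circle_powr_integrable holf \<open>P > 0\<close>) auto
    have "I \<le> integral (cbox 0 (2*pi)) (\<lambda>\<theta>. b powr P)"
      unfolding I_def using ab(2) \<open>P > 0\<close>
      by (intro integral_le circle_powr_integrable holf integrable_const) (auto intro: powr_mono2)
    then have "1 / (2*pi) * I \<le> b powr P"
      by (simp add: field_simps)
    then have 2: "(1 / (2*pi) * I) powr (1 / P) \<le> (b powr P) powr (1 / P)"
      using \<open>P > 0\<close> \<open>I \<ge> 0\<close> by (intro powr_mono2) auto
    from 1 2 show ?thesis
      using \<open>P > 0\<close> \<open>a \<ge> 0\<close> \<open>b \<ge> 0\<close> integral_mean_finite[OF holf \<open>p > 0\<close> False, of r]
      by (simp add: powr_powr I_def P_def)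
  qed
  then show "a \<le> integral_mean p f r" "integral_mean p f r \<le> b" by auto
qed

text \<open>On one period of the closed strip |G| attains its maximum. Either this happens on an
  edge, or the maximum principle makes \<open>G\<close> constant and the left edge attains it as
  well.\<close>

lemma circle_sup_quasiconvex:
  assumes holf: "f holomorphic_on UNIV" and r: "0 < r1" "r1 \<le> r" "r \<le> r2"
  shows "r powr l * integral_mean \<infinity> f r
           \<le> max (r1 powr l * integral_mean \<infinity> f r1) (r2 powr l * integral_mean \<infinity> f r2)"
proof -
  define G where "G = (\<lambda>s. exp (of_real l * s) * f (exp s))"
  define K where "K = {ln r1..ln r2} \<times> {0..2*pi}"
  have holG: "G holomorphic_on UNIV"
    unfolding G_def using holf by (rule comp_exp_holomorphic)
  have cG: "cmod (G (Complex (ln x) \<theta>)) = x powr l * cmod (f (of_real x * cis \<theta>))" if "x > 0" for x \<theta>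
    unfolding G_def norm_mult_comp_exp_Complex using that by simp
  have le: "cmod (G (Complex (ln x) \<theta>)) \<le> x powr l * integral_mean \<infinity> f x"
    if "x > 0" "\<theta> \<in> {0..2*pi}" for x \<theta>
    unfolding cG[OF that(1)] integral_mean_infinity using that
    by (intro mult_left_mono cSUP_upper bdd_above_circle holf) auto
  have "compact K" "K \<noteq> {}"
    unfolding K_def using r by (auto intro: compact_Times)
  moreover have "continuous_on K (\<lambda>z. cmod (G (Complex (fst z) (snd z))))"
    unfolding Complex_eq
    by (intro continuous_on_norm continuous_on_compose2[OF holomorphic_on_imp_continuous_on[OF holG]])
      (auto intro!: continuous_intros)
  ultimately obtain t0 \<theta>0 where m: "(t0, \<theta>0) \<in> K"
      "\<And>t \<theta>. (t, \<theta>) \<in> K \<Longrightarrow> cmod (G (Complex t \<theta>)) \<le> cmod (G (Complex t0 \<theta>0))"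
    using continuous_attains_sup[of K "\<lambda>z. cmod (G (Complex (fst z) (snd z)))"] by fastforce
  define B where "B = cmod (G (Complex t0 \<theta>0))"
  have "B \<le> max (r1 powr l * integral_mean \<infinity> f r1) (r2 powr l * integral_mean \<infinity> f r2)"
  proof (cases "t0 = ln r1 \<or> t0 = ln r2")
    case True
    then show ?thesis
      using le[of r1 \<theta>0] le[of r2 \<theta>0] m(1) r unfolding B_def K_def by auto
  next
    case False
    \<comment> \<open>The full open strip, unbounded in the imaginary direction, so that the maximum
      point is interior even when \<theta>0 is 0 or 2 pi. Periodicity of |G| extends the bound from
      one period to \<open>U\<close>.\<close>
    define U where "U = {z. ln r1 < Re z \<and> Re z < ln r2}"
    have GB: "cmod (G z) \<le> B" if "z \<in> U" for z
    proof -
      obtain \<phi> where \<phi>: "\<phi> \<in> {0..2*pi}" "cis (Im z) = cis \<phi>"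
      proof
        show "Arg2pi (cis (Im z)) \<in> {0..2*pi}"
          using Arg2pi_ge_0 Arg2pi_lt_2pi by (simp add: less_imp_le)
        show "cis (Im z) = cis (Arg2pi (cis (Im z)))"
          using Arg2pi_eq[of "cis (Im z)"] by (simp add: cis_conv_exp)
      qed
      have "cmod (G z) = cmod (G (Complex (Re z) \<phi>))"
        using norm_mult_comp_exp_Complex[of l "Re z" "Im z" f]
          norm_mult_comp_exp_Complex[of l "Re z" \<phi> f] \<phi>(2)
        unfolding G_def by simp
      then show ?thesis using m(2) that \<phi>(1) by (simp add: U_def K_def B_def)
    qed
    have "G constant_on UNIV"
    proof (rule maximum_modulus_principle[OF holG, where U = U and \<xi> = "Complex t0 \<theta>0"])
      show "open U"
        unfolding U_def by (intro open_Collect_conj open_Collect_less continuous_intros)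
      show "Complex t0 \<theta>0 \<in> U"
        using m(1) False by (auto simp: U_def K_def)
    qed (use GB in \<open>auto simp: B_def\<close>)
    then have "B = cmod (G (Complex (ln r1) 0))"
      unfolding B_def constant_on_def by (metis UNIV_I)
    then show ?thesis using le[of r1 0] r by auto
  qed
  moreover have "r powr l * cmod (f (of_real r * cis \<theta>)) \<le> B" if "\<theta> \<in> {0..2*pi}" for \<theta>
    using m(2)[of "ln r" \<theta>] that r cG[of r \<theta>] by (simp add: K_def B_def)
  then have "integral_mean \<infinity> f r \<le> B / r powr l"
    unfolding integral_mean_infinity using r by (intro cSUP_least) (auto simp: field_simps)
  then have "r powr l * integral_mean \<infinity> f r \<le> B"
    using r by (simp add: field_simps)
  ultimately show ?thesis by linarith
qed

text \<open>A bound by a maximum, unlike convexity itself, passes directly through the increasing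
  map \<open>x powr (1 / P)\<close>. No constant enters, which is why the final constants do not
  depend on \<open>p\<close>.\<close>

lemma integral_mean_quasiconvex:
  assumes holf: "f holomorphic_on UNIV" and "p > 0" and r: "0 < r1" "r1 \<le> r" "r \<le> r2"
  shows "r powr l * integral_mean p f r
           \<le> max (r1 powr l * integral_mean p f r1) (r2 powr l * integral_mean p f r2)"
proof (cases "p = \<infinity>")
  case True
  then show ?thesis using circle_sup_quasiconvex[OF holf r] by simp
next
  case False
  define P where "P = enn2real p"
  have "P > 0"
    using False \<open>p > 0\<close> by (simp add: P_def enn2real_positive_iff less_top)
  define I where "I = (\<lambda>r. integral (cbox 0 (2*pi)) (\<lambda>\<theta>. cmod (f (of_real r * cis \<theta>)) powr P))"
  have I: "I x \<ge> 0" for x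
    unfolding I_def by (intro integral_nonneg circle_powr_integrable holf \<open>P > 0\<close>) auto
  define E where "E = (\<lambda>x. 1 / (2*pi) * (x powr (l * P) * I x))"
  have E: "x powr l * integral_mean p f x = E x powr (1 / P)" "E x \<ge> 0" if "x > 0" for x
  proof -
    have "E x powr (1 / P) = (x powr (l * P)) powr (1 / P) * (1 / (2*pi) * I x) powr (1 / P)"
      unfolding E_def using I[of x] by (subst powr_mult[symmetric]) (auto simp: ac_simps)
    also have "(x powr (l * P)) powr (1 / P) = x powr l"
      using \<open>P > 0\<close> by (simp add: powr_powr)
    also have "(1 / (2*pi) * I x) powr (1 / P) = integral_mean p f x"
      using integral_mean_finite[OF holf \<open>p > 0\<close> False] by (simp add: I_def P_def)
    finally show "x powr l * integral_mean p f x = E x powr (1 / P)" by simp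
    show "E x \<ge> 0" unfolding E_def using I[of x] by simp
  qed
  have "r powr (l * P) * I r \<le> max (r1 powr (l * P) * I r1) (r2 powr (l * P) * I r2)"
    unfolding I_def using holf \<open>P > 0\<close> r by (rule circle_powr_integral_quasiconvex)
  then have "E r \<le> E r1 \<or> E r \<le> E r2"
    unfolding E_def by (auto simp: le_max_iff_disj divide_right_mono)
  then have "E r powr (1 / P) \<le> E r1 powr (1 / P) \<or> E r powr (1 / P) \<le> E r2 powr (1 / P)"
    using \<open>P > 0\<close> E(2) r by (auto intro: powr_mono2)
  then show ?thesis using E(1) r by (simp add: le_max_iff_disj)
qed

section \<open>Powers of extended nonnegative reals\<close>

lemma epowr_ennreal: "u \<ge> 0 \<Longrightarrow> epowr (ennreal u) a = ennreal (u powr a)"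
  by (simp add: epowr_def)

lemma epowr_mono: "x \<le> y \<Longrightarrow> a \<ge> 0 \<Longrightarrow> epowr x a \<le> epowr y a"
  by (auto simp: epowr_def top_unique less_top intro!: ennreal_leI powr_mono2 enn2real_mono)

lemma epowr_epowr_inverse: "a \<noteq> 0 \<Longrightarrow> epowr (epowr x a) (1 / a) = x"
  by (simp add: epowr_def powr_powr less_top)

text \<open>Both the power and its inverse \<open>epowr _ (1 / a)\<close> are monotone, so bounding
  the powers by \<open>y\<close> amounts to bounding the \<open>g i\<close> by the root of
  \<open>y\<close>; no continuity argument is involved.\<close>

lemma epowr_SUP_le:
  assumes "a > 0" and "\<And>i. i \<in> A \<Longrightarrow> epowr (g i) a \<le> y"
  shows "epowr (SUP i\<in>A. g i) a \<le> y"
proof -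
  have "g i \<le> epowr y (1 / a)" if "i \<in> A" for i
    using epowr_mono[OF assms(2)[OF that], of "1 / a"] \<open>a > 0\<close> by (simp add: epowr_epowr_inverse)
  then have "epowr (SUP i\<in>A. g i) a \<le> epowr (epowr y (1 / a)) a"
    using \<open>a > 0\<close> by (intro epowr_mono SUP_least) auto
  also have "\<dots> = y"
    using epowr_epowr_inverse[of "1 / a" y] \<open>a > 0\<close> by simp
  finally show ?thesis .
qed

section \<open>Monotonicity of the integral means in the radius\<close>

lemma integral_mean_nonneg:
  assumes "f holomorphic_on UNIV" "p > 0"
  shows "integral_mean p f r \<ge> 0"
proof (cases "p = \<infinity>")
  case True
  then show ?thesis
    unfolding True integral_mean_infinity
    by (intro cSUP_upper2[where x = 0] bdd_above_circle assms) auto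
qed (simp add: integral_mean_def)

text \<open>For \<open>l > 0\<close> the end point bound on [x, s] loses its left term as x tends to
  0, because the means stay bounded there. This gives
  \<open>r powr l * M r \<le> s powr l * M s\<close>, and then \<open>l\<close> tends to 0.
  Monotonicity serves the block at the origin and measurability.\<close>

lemma integral_mean_mono:
  assumes holf: "f holomorphic_on UNIV" and "p > 0" and "0 \<le> r" "r \<le> s"
  shows "integral_mean p f r \<le> integral_mean p f s"
proof -
  let ?M = "integral_mean p f"
  have contf: "continuous_on UNIV f"
    using holf by (rule holomorphic_on_imp_continuous_on)
  have pos: "?M r \<le> ?M s" if "0 < r" "r \<le> s" for r
  proof -
    have "compact (f ` cball 0 s)"
      by (intro compact_continuous_image continuous_on_subset[OF contf]) auto
    then obtain b where b: "\<And>z. z \<in> cball 0 s \<Longrightarrow> cmod (f z) \<le> b"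
      using compact_imp_bounded by (metis bounded_iff image_eqI)
    have "r powr l * ?M r \<le> s powr l * ?M s" if "l > 0" for l
    proof -
      have "((\<lambda>x. x powr l) \<longlongrightarrow> 0 powr l) (at_right (0::real))"
        using \<open>l > 0\<close> by (intro tendsto_intros) (auto simp: eventually_at_filter)
      then have lim: "((\<lambda>x. max (x powr l * b) (s powr l * ?M s)) \<longlongrightarrow> max (0 * b) (s powr l * ?M s)) (at_right 0)"
        by (intro tendsto_intros) simp
      have "r powr l * ?M r \<le> max (x powr l * b) (s powr l * ?M s)" if "0 < x" "x < r" for x
      proof -
        have "?M x \<le> b"
          using that \<open>r \<le> s\<close> by (intro integral_mean_bounds(2)[where a = 0] holf \<open>p > 0\<close> b)
            (auto simp: norm_mult)
        have "r powr l * ?M r \<le> max (x powr l * ?M x) (s powr l * ?M s)"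
          using that \<open>r \<le> s\<close> by (intro integral_mean_quasiconvex holf \<open>p > 0\<close>) auto
        also have "\<dots> \<le> max (x powr l * b) (s powr l * ?M s)"
          using \<open>?M x \<le> b\<close> by (intro max.mono mult_left_mono) auto
        finally show ?thesis .
      qed
      then have "eventually (\<lambda>x. r powr l * ?M r \<le> max (x powr l * b) (s powr l * ?M s)) (at_right 0)"
        using \<open>0 < r\<close> by (auto simp: eventually_at_right_field)
      then have "r powr l * ?M r \<le> max (0 * b) (s powr l * ?M s)"
        by (intro tendsto_le[OF _ lim tendsto_const]) auto
      moreover have "0 \<le> s powr l * ?M s"
        by (intro mult_nonneg_nonneg integral_mean_nonneg holf \<open>p > 0\<close>) simp
      ultimately show ?thesis by simp
    qed
    then have ev: "eventually (\<lambda>l. r powr l * ?M r \<le> s powr l * ?M s) (at_right 0)"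
      by (auto simp: eventually_at_filter)
    have lim0: "((\<lambda>l. x powr l * ?M x) \<longlongrightarrow> x powr 0 * ?M x) (at_right 0)" if "x > 0" for x
      using that by (intro tendsto_intros) auto
    have "s > 0" using that by simp
    from tendsto_le[OF _ lim0[OF this] lim0[OF \<open>0 < r\<close>] ev] show ?thesis
      using that by simp
  qed
  show ?thesis
  proof (cases "r = 0 \<and> s > 0")
    case True
    have "?M 0 \<le> cmod (f 0)"
      by (rule integral_mean_bounds(2)[where a = 0]) (use holf \<open>p > 0\<close> in auto)
    \<comment> \<open>By continuity at 0, |f| is at least |f 0| - \<delta> on a small circle of
      radius \<open>x \<le> s\<close>; the case of positive radii then leads from \<open>x\<close>
      to \<open>s\<close>.\<close>
    also have "cmod (f 0) \<le> ?M s"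
    proof (rule field_le_epsilon)
      fix \<delta> :: real assume "\<delta> > 0"
      obtain \<eta> where \<eta>: "\<eta> > 0" "\<And>z. cmod z < \<eta> \<Longrightarrow> cmod (f z - f 0) < \<delta>"
        using contf \<open>\<delta> > 0\<close> unfolding continuous_on_iff by (metis UNIV_I dist_norm diff_zero)
      define x where "x = min s (\<eta> / 2)"
      have x: "0 < x" "x \<le> s" "x < \<eta>" using \<eta>(1) True by (auto simp: x_def)
      obtain b where b: "\<And>\<theta>. cmod (f (of_real x * cis \<theta>)) \<le> b"
      proof
        fix \<theta> show "cmod (f (of_real x * cis \<theta>)) \<le> cmod (f 0) + \<delta>"
          using \<eta>(2)[of "of_real x * cis \<theta>"] x norm_triangle_ineq2[of "f (of_real x * cis \<theta>)" "f 0"]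
          by (simp add: norm_mult)
      qed
      \<comment> \<open>Truncation at 0 supplies the nonnegative lower bound that
        \<open>integral_mean_bounds\<close> asks for.\<close>
      have "max 0 (cmod (f 0) - \<delta>) \<le> ?M x"
      proof (rule integral_mean_bounds(1)[OF holf \<open>p > 0\<close> _ _ b])
        fix \<theta>
        show "max 0 (cmod (f 0) - \<delta>) \<le> cmod (f (of_real x * cis \<theta>))"
          using \<eta>(2)[of "of_real x * cis \<theta>"] x norm_triangle_ineq3[of "f (of_real x * cis \<theta>)" "f 0"]
          by (simp add: norm_mult)
      qed simp
      then show "cmod (f 0) \<le> ?M s + \<delta>" using pos[OF x(1,2)] by simp
    qed
    finally show ?thesis using True by simp
  next
    case False
    then show ?thesis using pos[of r] assms by (cases "r = 0") auto
  qed
qed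

section \<open>Lower bounds for the weighted mean near a given radius\<close>

definition weighted_mean :: "real \<Rightarrow> ennreal \<Rightarrow> (complex \<Rightarrow> complex) \<Rightarrow> real \<Rightarrow> real" where
  "weighted_mean \<alpha> p f r = integral_mean p f r * exp (- (\<alpha> / 2) * r\<^sup>2)"

lemma weighted_mean_nonneg:
  "f holomorphic_on UNIV \<Longrightarrow> p > 0 \<Longrightarrow> weighted_mean \<alpha> p f r \<ge> 0"
  by (simp add: weighted_mean_def integral_mean_nonneg)

text \<open>The last hypothesis bounds the ratio of weighted means from below by exp of \<alpha>
  r0^2 (ln r - ln r0) - \<alpha>/2 (r^2 - r0^2). With r = r0 (1 + y) the terms linear in y cancel,
  and the quadratic remainder is of order \<alpha> (r - r0)^2, without any growth in r0.\<close>

lemma weighted_mean_lower_bound: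
  assumes "\<alpha> > 0" and r: "r0 \<ge> 1" "\<bar>r - r0\<bar> \<le> 1/2"
    and M0: "integral_mean p f r0 \<ge> 0"
    and M: "r0 powr (- \<alpha> * r0\<^sup>2) * integral_mean p f r0 \<le> r powr (- \<alpha> * r0\<^sup>2) * integral_mean p f r"
  shows "exp (- 9 * \<alpha> / 8) * weighted_mean \<alpha> p f r0 \<le> weighted_mean \<alpha> p f r"
proof -
  have r0: "r > 0" using r by linarith
  define y where "y = r / r0 - 1"
  have ry: "r = r0 * (1 + y)" using r by (simp add: y_def)
  have "\<bar>y\<bar> = \<bar>r - r0\<bar> / r0" using r by (simp add: y_def field_simps abs_divide)
  also have "\<dots> \<le> \<bar>r - r0\<bar> / 1" using r by (intro divide_left_mono) auto
  finally have y: "\<bar>y\<bar> \<le> 1/2" using r by simp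
  have "ln r = ln r0 + ln (1 + y)"
    using r y unfolding ry by (subst ln_mult) auto
  then have "\<alpha> * r0\<^sup>2 * (ln r - ln r0) - \<alpha> / 2 * (r\<^sup>2 - r0\<^sup>2)
      = \<alpha> * r0\<^sup>2 * (ln (1 + y) - y - y\<^sup>2 / 2)"
    unfolding ry by (simp add: power2_eq_square algebra_simps)
  \<comment> \<open>From |ln(1 + y) - y| \<le> 2 y^2 for |y| \<le> 1/2; together with y^2 / 2 this
    makes 5/2.\<close>
  also have "\<dots> \<ge> \<alpha> * r0\<^sup>2 * (- (5/2) * y\<^sup>2)"
    using abs_ln_one_plus_x_minus_x_bound[OF y] \<open>\<alpha> > 0\<close> by (intro mult_left_mono) auto
  also have "\<alpha> * r0\<^sup>2 * (- (5/2) * y\<^sup>2) = - (5/2) * \<alpha> * (r - r0)\<^sup>2"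
    unfolding ry by (simp add: power2_eq_square algebra_simps)
  \<comment> \<open>The distance 1/2 gives -5 \<alpha>/8; the weaker 9/8 is the constant dictated by
    the block at the origin.\<close>
  also have "\<dots> \<ge> - 9 * \<alpha> / 8"
    using power_mono[OF r(2), of 2] \<open>\<alpha> > 0\<close> by (simp add: power2_eq_square)
  finally have ex: "- 9 * \<alpha> / 8 \<le> \<alpha> * r0\<^sup>2 * (ln r - ln r0) - \<alpha> / 2 * (r\<^sup>2 - r0\<^sup>2)" .
  let ?m = "integral_mean p f r0"
  have "exp (- 9 * \<alpha> / 8) * weighted_mean \<alpha> p f r0
      = ?m * exp (- 9 * \<alpha> / 8 - \<alpha> / 2 * r0\<^sup>2)"
    unfolding weighted_mean_def diff_conv_add_uminus exp_add by simp
  also have "\<dots> \<le> ?m * exp (\<alpha> * r0\<^sup>2 * (ln r - ln r0) - \<alpha> / 2 * r\<^sup>2)"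
    using M0 ex by (intro mult_left_mono) (auto simp: algebra_simps)
  also have "\<dots> = (r0 powr (- \<alpha> * r0\<^sup>2) * ?m) * exp (\<alpha> * r0\<^sup>2 * ln r - \<alpha> / 2 * r\<^sup>2)"
    using r by (simp add: powr_def algebra_simps flip: exp_add)
  also have "\<dots> \<le> (r powr (- \<alpha> * r0\<^sup>2) * integral_mean p f r) * exp (\<alpha> * r0\<^sup>2 * ln r - \<alpha> / 2 * r\<^sup>2)"
    using M by (intro mult_right_mono) auto
  also have "\<dots> = weighted_mean \<alpha> p f r"
    using r0 by (simp add: powr_def weighted_mean_def algebra_simps flip: exp_add)
  finally show ?thesis .
qed

text \<open>For k \<ge> 1, if \<open>r powr (- \<alpha> * r0\<^sup>2) * M r\<close> drops below its
  value at \<open>r0\<close> somewhere on the left, the end point bound forces it to be at least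
  that value everywhere on the right. So one of the two sides always works. The bound on
  \<open>a\<close> makes the weight r comparable to 1 + k; the left choice a = r0 - 1/2 is at least
  k - 1/2, which equals (k + 1)/4 at k = 1.\<close>

lemma block_witness:
  assumes "\<alpha> > 0" and holf: "f holomorphic_on UNIV" and "p > 0" and r0: "real k \<le> r0" "r0 < real k + 1"
  obtains a where "a \<ge> (real k + 1) / 4" "{a..a + 1/2} \<subseteq> {real k - 1..<real k + 2}"
    "\<And>r. r \<in> {a..a + 1/2} \<Longrightarrow> exp (- 9 * \<alpha> / 8) * weighted_mean \<alpha> p f r0 \<le> weighted_mean \<alpha> p f r"
proof (cases "k = 0")
  case True
  show ?thesis
  \<comment> \<open>Here \<open>r0\<close> may be 0, so plain monotonicity of the mean from
    \<open>r0 < 1\<close> to \<open>r \<ge> 1\<close> is used. The Gaussian costs at most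
    exp(-(\<alpha>/2)(3/2)^2) = exp(-9 \<alpha>/8).\<close>
  proof (rule that[of 1])
    fix r :: real assume r: "r \<in> {1..1 + 1/2}"
    have "r\<^sup>2 \<le> (3/2)\<^sup>2" using r by (intro power_mono) auto
    then have "\<alpha> / 2 * r\<^sup>2 \<le> \<alpha> / 2 * (3/2)\<^sup>2"
      using \<open>\<alpha> > 0\<close> by (intro mult_left_mono) auto
    moreover have "0 \<le> \<alpha> / 2 * r0\<^sup>2"
      using \<open>\<alpha> > 0\<close> by simp
    ultimately have "- 9 * \<alpha> / 8 + - (\<alpha> / 2) * r0\<^sup>2 \<le> - (\<alpha> / 2) * r\<^sup>2"
      unfolding power_divide by simp
    then have e: "exp (- 9 * \<alpha> / 8) * exp (- (\<alpha> / 2) * r0\<^sup>2) \<le> exp (- (\<alpha> / 2) * r\<^sup>2)"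
      by (simp flip: exp_add)
    have "integral_mean p f r0 * (exp (- 9 * \<alpha> / 8) * exp (- (\<alpha> / 2) * r0\<^sup>2))
        \<le> integral_mean p f r * exp (- (\<alpha> / 2) * r\<^sup>2)"
      using r r0 True e
      by (intro mult_mono integral_mean_mono integral_mean_nonneg holf \<open>p > 0\<close>) auto
    then show "exp (- 9 * \<alpha> / 8) * weighted_mean \<alpha> p f r0 \<le> weighted_mean \<alpha> p f r"
      by (simp add: weighted_mean_def algebra_simps)
  qed (use True in auto)
next
  case False
  then have k: "real k \<ge> 1" by simp
  let ?g = "\<lambda>r. r powr (- \<alpha> * r0\<^sup>2) * integral_mean p f r"
  have *: "exp (- 9 * \<alpha> / 8) * weighted_mean \<alpha> p f r0 \<le> weighted_mean \<alpha> p f r"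
    if "?g r0 \<le> ?g r" "\<bar>r - r0\<bar> \<le> 1/2" for r
    using weighted_mean_lower_bound[OF \<open>\<alpha> > 0\<close> _ that(2) _ that(1)] k r0
      integral_mean_nonneg[OF holf \<open>p > 0\<close>] by simp
  show ?thesis
  proof (cases "\<forall>r\<in>{r0 - 1/2..r0}. ?g r0 \<le> ?g r")
    case True
    show ?thesis
    proof (rule that[of "r0 - 1/2"])
      fix r assume "r \<in> {r0 - 1/2..r0 - 1/2 + 1/2}"
      then show "exp (- 9 * \<alpha> / 8) * weighted_mean \<alpha> p f r0 \<le> weighted_mean \<alpha> p f r"
        using True by (intro *) auto
    qed (use k r0 in auto)
  next
    case False
    then obtain r1 where r1: "r0 - 1/2 \<le> r1" "r1 \<le> r0" "?g r1 < ?g r0"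
      by (auto simp: not_le)
    have right: "?g r0 \<le> ?g r" if "r \<ge> r0" for r
      using integral_mean_quasiconvex[OF holf \<open>p > 0\<close>, of r1 r0 r "- \<alpha> * r0\<^sup>2"] r1 k r0 that
      by auto
    show ?thesis
    proof (rule that[of r0])
      fix r assume "r \<in> {r0..r0 + 1/2}"
      then show "exp (- 9 * \<alpha> / 8) * weighted_mean \<alpha> p f r0 \<le> weighted_mean \<alpha> p f r"
        by (intro * right) auto
    qed (use k r0 in auto)
  qed
qed

section \<open>Comparison of the radial integral with the block sum\<close>

definition fock_density :: "real \<Rightarrow> ennreal \<Rightarrow> real \<Rightarrow> (complex \<Rightarrow> complex) \<Rightarrow> real \<Rightarrow> ennreal" where
  "fock_density \<alpha> p q f r =
     ennreal (\<alpha> * q * weighted_mean \<alpha> p f r powr q * r) * indicator {0..} r"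

lemma epowr_fock_norm:
  assumes "q > 0"
  shows "epowr (fock_norm \<alpha> p (ennreal q) f) q = (\<integral>\<^sup>+ r. fock_density \<alpha> p q f r \<partial>lborel)"
proof -
  have "exp (- (\<alpha> / 2) * r\<^sup>2) powr q = exp (- (\<alpha> * q / 2) * r\<^sup>2)" for r
    by (simp add: powr_def algebra_simps)
  then have eq: "integral_mean p f r powr q * \<alpha> * q * exp (- (\<alpha> * q / 2) * r\<^sup>2) * r
      = \<alpha> * q * weighted_mean \<alpha> p f r powr q * r" for r
    by (simp add: weighted_mean_def powr_mult)
  have "fock_norm \<alpha> p (ennreal q) f = epowr (\<integral>\<^sup>+ r. fock_density \<alpha> p q f r \<partial>lborel) (1 / q)"
    unfolding fock_norm_def fock_density_def enn2real_ennreal[OF less_imp_le[OF \<open>q > 0\<close>]] eq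
    by simp
  then show ?thesis
    using \<open>q > 0\<close> epowr_epowr_inverse[of "1 / q"] by simp
qed

text \<open>A monotone function is Borel; \<open>max 0 r\<close> extends the mean monotonically to
  the whole line without changing the density.\<close>

lemma fock_density_measurable:
  assumes holf: "f holomorphic_on UNIV" "p > 0"
  shows "fock_density \<alpha> p q f \<in> borel_measurable borel"
proof -
  have "mono (\<lambda>r. integral_mean p f (max 0 r))"
    using assms by (intro monoI integral_mean_mono) auto
  then have [measurable]: "(\<lambda>r. integral_mean p f (max 0 r)) \<in> borel_measurable borel"
    by (rule borel_measurable_mono)
  have "fock_density \<alpha> p q f = (\<lambda>r. ennreal (\<alpha> * q * (integral_mean p f (max 0 r)
      * exp (- (\<alpha> / 2) * r\<^sup>2)) powr q * r) * indicator {0..} r)"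
    by (auto simp: fun_eq_iff fock_density_def weighted_mean_def indicator_def)
  also have "\<dots> \<in> borel_measurable borel"
    by measurable
  finally show ?thesis .
qed

lemma block_sup_weighted_mean:
  "block_sup \<alpha> p f k = (SUP r\<in>{real k..<real k + 1}. ennreal (weighted_mean \<alpha> p f r))"
  by (simp add: block_sup_def weighted_mean_def)

text \<open>On block k, which has length 1, the weighted mean is at most its supremum and r is at
  most 1 + k.\<close>

lemma fock_integral_le_block_sum:
  assumes "\<alpha> > 0" "q > 0" and holf: "f holomorphic_on UNIV" "p > 0"
  shows "(\<integral>\<^sup>+ r. fock_density \<alpha> p q f r \<partial>lborel)
    \<le> ennreal (\<alpha> * q) * (\<Sum>k. of_nat (1 + k) * epowr (block_sup \<alpha> p f k) q)"
proof -
  define c where "c = (\<lambda>k. ennreal (\<alpha> * q) * (of_nat (1 + k) * epowr (block_sup \<alpha> p f k) q))"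
  let ?J = "\<lambda>k::nat. {real k..<real k + 1}"
  have "fock_density \<alpha> p q f r \<le> (\<Sum>k. c k * indicator (?J k) r)" for r
  proof (cases "r \<ge> 0")
    case True
    define k where "k = nat \<lfloor>r\<rfloor>"
    have k: "r \<in> ?J k" using True by (auto simp: k_def)
    have "ennreal (weighted_mean \<alpha> p f r) \<le> block_sup \<alpha> p f k"
      unfolding block_sup_weighted_mean using k by (intro SUP_upper)
    then have "ennreal (weighted_mean \<alpha> p f r powr q) \<le> epowr (block_sup \<alpha> p f k) q"
      using epowr_mono[of "ennreal (weighted_mean \<alpha> p f r)" _ q] \<open>q > 0\<close>
      by (simp add: epowr_ennreal weighted_mean_nonneg holf)
    moreover have "ennreal r \<le> of_nat (1 + k)"
      using k unfolding ennreal_of_nat_eq_real_of_nat by (intro ennreal_leI) auto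
    ultimately have "ennreal (\<alpha> * q) * (ennreal r * ennreal (weighted_mean \<alpha> p f r powr q)) \<le> c k"
      unfolding c_def by (intro mult_left_mono mult_mono) auto
    also have "ennreal (\<alpha> * q) * (ennreal r * ennreal (weighted_mean \<alpha> p f r powr q))
        = fock_density \<alpha> p q f r"
      using True \<open>\<alpha> > 0\<close> \<open>q > 0\<close>
      by (simp add: fock_density_def ennreal_mult'[symmetric] ennreal_mult''[symmetric] ac_simps)
    also have "c k = (\<Sum>j\<in>{k}. c j * indicator (?J j) r)"
      using k by simp
    also have "\<dots> \<le> (\<Sum>k. c k * indicator (?J k) r)"
      by (intro sum_le_suminf) auto
    finally show ?thesis .
  qed (simp add: fock_density_def)
  then have "(\<integral>\<^sup>+ r. fock_density \<alpha> p q f r \<partial>lborel) \<le> (\<integral>\<^sup>+ r. (\<Sum>k. c k * indicator (?J k) r) \<partial>lborel)"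
    by (intro nn_integral_mono)
  also have "\<dots> = (\<Sum>k. \<integral>\<^sup>+ r. c k * indicator (?J k) r \<partial>lborel)"
    by (intro nn_integral_suminf) auto
  also have "\<dots> = (\<Sum>k. c k)"
    by (simp add: nn_integral_cmult_indicator)
  also have "\<dots> = ennreal (\<alpha> * q) * (\<Sum>k. of_nat (1 + k) * epowr (block_sup \<alpha> p f k) q)"
    unfolding c_def by (rule ennreal_suminf_cmult)
  finally show ?thesis .
qed

text \<open>Integrate over the interval of \<open>block_witness\<close> only. There the q-th power
  loses exp(-9 \<alpha> q/8), the weight r is at least (k + 1)/4 and the length is 1/2, whence the
  factor 1/8 in \<open>c\<close>.\<close>

lemma weighted_mean_powr_le_local_integral:
  fixes \<alpha> q :: real
  defines "c \<equiv> \<alpha> * q * exp (- 9 * \<alpha> * q / 8) / 8"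
  assumes "\<alpha> > 0" "q > 0" and holf: "f holomorphic_on UNIV" "p > 0"
    and r0: "real k \<le> r0" "r0 < real k + 1"
  shows "ennreal (c * (1 + real k) * weighted_mean \<alpha> p f r0 powr q)
    \<le> (\<integral>\<^sup>+ r. fock_density \<alpha> p q f r * indicator {real k - 1..<real k + 2} r \<partial>lborel)"
proof -
  let ?V = "weighted_mean \<alpha> p f"
  obtain a where a: "a \<ge> (real k + 1) / 4" "{a..a + 1/2} \<subseteq> {real k - 1..<real k + 2}"
    "\<And>r. r \<in> {a..a + 1/2} \<Longrightarrow> exp (- 9 * \<alpha> / 8) * ?V r0 \<le> ?V r"
    using block_witness[OF \<open>\<alpha> > 0\<close> holf r0] by blast
  have V0: "?V r0 \<ge> 0" by (intro weighted_mean_nonneg holf)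
  define d where "d = \<alpha> * q * (exp (- 9 * \<alpha> / 8) * ?V r0) powr q * ((real k + 1) / 4)"
  have "exp (- 9 * \<alpha> / 8) powr q = exp (- 9 * \<alpha> * q / 8)"
    by (simp add: powr_def)
  then have d: "d * (1/2) = c * (1 + real k) * ?V r0 powr q"
    using V0 by (simp add: d_def c_def powr_mult)
  have le: "ennreal d * indicator {a..a + 1/2} r
      \<le> fock_density \<alpha> p q f r * indicator {real k - 1..<real k + 2} r" for r
  proof (cases "r \<in> {a..a + 1/2}")
    case True
    have "d \<le> \<alpha> * q * ?V r powr q * r"
      unfolding d_def using True a V0 \<open>\<alpha> > 0\<close> \<open>q > 0\<close>
      by (intro mult_mono powr_mono2 mult_nonneg_nonneg) auto
    moreover have "r \<in> {0..}" "r \<in> {real k - 1..<real k + 2}" using True a(1,2) by auto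
    ultimately show ?thesis
      using True by (simp add: fock_density_def ennreal_leI)
  qed simp
  have "ennreal (d * (1/2)) = (\<integral>\<^sup>+ r. ennreal d * indicator {a..a + 1/2} r \<partial>lborel)"
    by (subst nn_integral_cmult_indicator) (simp_all only: emeasure_lborel_Icc ennreal_mult'', simp_all)
  also have "\<dots> \<le> (\<integral>\<^sup>+ r. fock_density \<alpha> p q f r * indicator {real k - 1..<real k + 2} r \<partial>lborel)"
    by (intro nn_integral_mono le)
  finally show ?thesis unfolding d .
qed

text \<open>The local bound is uniform in the point of the block, so it holds for the supremum.
  Summation over k counts each radius at most three times, since the intervals [k - 1, k + 2) have
  length 3.\<close>

lemma block_sum_le_fock_integral:
  fixes \<alpha> q :: real
  defines "c \<equiv> \<alpha> * q * exp (- 9 * \<alpha> * q / 8) / 8"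
  assumes "\<alpha> > 0" "q > 0" and holf: "f holomorphic_on UNIV" "p > 0"
  shows "(\<Sum>k. of_nat (1 + k) * epowr (block_sup \<alpha> p f k) q)
    \<le> ennreal (3 / c) * (\<integral>\<^sup>+ r. fock_density \<alpha> p q f r \<partial>lborel)"
proof -
  \<comment> \<open>For k = 0 this interval reaches below 0, where the density vanishes.\<close>
  let ?L = "\<lambda>k::nat. {real k - 1..<real k + 2}"
  let ?H = "fock_density \<alpha> p q f"
  define I where "I = (\<lambda>k. \<integral>\<^sup>+ r. ?H r * indicator (?L k) r \<partial>lborel)"
  have "c > 0" using \<open>\<alpha> > 0\<close> \<open>q > 0\<close> by (simp add: c_def)
  note [measurable] = fock_density_measurable[OF holf]
  have "of_nat (1 + k) * epowr (block_sup \<alpha> p f k) q \<le> ennreal (1 / c) * I k" for k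
  proof -
    define e where "e = c * (1 + real k)"
    have cancel: "x * (1 / (c * x)) = 1 / c" if "x > 0" for x
      using that by simp
    have e: "e > 0" using \<open>c > 0\<close> by (simp add: e_def)
    have "epowr (block_sup \<alpha> p f k) q \<le> ennreal (1 / e) * I k"
      unfolding block_sup_weighted_mean
    proof (rule epowr_SUP_le[OF \<open>q > 0\<close>])
      fix r assume r: "r \<in> {real k..<real k + 1}"
      have "epowr (ennreal (weighted_mean \<alpha> p f r)) q = ennreal (1 / e * (e * weighted_mean \<alpha> p f r powr q))"
        using e by (simp add: epowr_ennreal weighted_mean_nonneg holf)
      also have "\<dots> = ennreal (1 / e) * ennreal (e * weighted_mean \<alpha> p f r powr q)"
        using e by (intro ennreal_mult') simp
      also have "\<dots> \<le> ennreal (1 / e) * I k"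
        unfolding I_def e_def c_def using r assms
        by (intro mult_left_mono weighted_mean_powr_le_local_integral) auto
      finally show "epowr (ennreal (weighted_mean \<alpha> p f r)) q \<le> ennreal (1 / e) * I k" .
    qed
    then have "of_nat (1 + k) * epowr (block_sup \<alpha> p f k) q \<le> of_nat (1 + k) * (ennreal (1 / e) * I k)"
      by (intro mult_left_mono) auto
    also have "\<dots> = ennreal ((1 + real k) * (1 / e)) * I k"
      unfolding ennreal_of_nat_eq_real_of_nat mult.assoc[symmetric]
      by (subst ennreal_mult') (auto simp: e less_imp_le)
    also have "(1 + real k) * (1 / e) = 1 / c"
      using \<open>c > 0\<close> cancel[of "1 + real k"] by (simp add: e_def)
    finally show ?thesis .
  qed
  then have "(\<Sum>k. of_nat (1 + k) * epowr (block_sup \<alpha> p f k) q) \<le> (\<Sum>k. ennreal (1 / c) * I k)"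
    by (intro suminf_le) auto
  also have "\<dots> = ennreal (1 / c) * (\<Sum>k. I k)"
    by (rule ennreal_suminf_cmult)
  also have "(\<Sum>k. I k) = (\<integral>\<^sup>+ r. (\<Sum>k. ?H r * indicator (?L k) r) \<partial>lborel)"
    unfolding I_def by (intro nn_integral_suminf[symmetric]) measurable
  also have "\<dots> \<le> (\<integral>\<^sup>+ r. 3 * ?H r \<partial>lborel)"
  proof (intro nn_integral_mono)
    fix r
    \<comment> \<open>Only indices within 1 of the floor of \<open>r\<close> contribute. Truncated
      subtraction and \<open>nat\<close> at small or negative \<open>r\<close> still leave a set of
      at most three indices that contains all of these.\<close>
    have "(\<Sum>k. ?H r * indicator (?L k) r) = (\<Sum>k\<in>{nat \<lfloor>r\<rfloor> - 1..nat \<lfloor>r\<rfloor> + 1}. ?H r * indicator (?L k) r)"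
    proof (rule suminf_finite)
      fix k assume k: "k \<notin> {nat \<lfloor>r\<rfloor> - 1..nat \<lfloor>r\<rfloor> + 1}"
      have "r \<notin> ?L k"
      proof
        assume "r \<in> ?L k"
        then have "int k - 1 \<le> \<lfloor>r\<rfloor>" "\<lfloor>r\<rfloor> < int k + 2"
          by (auto simp: le_floor_iff floor_less_iff)
        with k show False by auto
      qed
      then show "?H r * indicator (?L k) r = 0" by simp
    qed simp
    also have "\<dots> \<le> (\<Sum>k\<in>{nat \<lfloor>r\<rfloor> - 1..nat \<lfloor>r\<rfloor> + 1}. ?H r)"
      by (intro sum_mono) (auto simp: indicator_def)
    also have "\<dots> = of_nat (card {nat \<lfloor>r\<rfloor> - 1..nat \<lfloor>r\<rfloor> + 1}) * ?H r"
      by simp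
    also have "\<dots> \<le> of_nat 3 * ?H r"
      by (intro mult_right_mono) (auto intro!: of_nat_mono simp del: of_nat_numeral)
    finally show "(\<Sum>k. ?H r * indicator (?L k) r) \<le> 3 * ?H r" by simp
  qed
  also have "(\<integral>\<^sup>+ r. 3 * ?H r \<partial>lborel) = 3 * (\<integral>\<^sup>+ r. ?H r \<partial>lborel)"
    by (intro nn_integral_cmult) measurable
  also have "ennreal (1 / c) * (3 * (\<integral>\<^sup>+ r. ?H r \<partial>lborel)) = ennreal (3 / c) * (\<integral>\<^sup>+ r. ?H r \<partial>lborel)"
  proof -
    have "ennreal (1 / c) * 3 = ennreal (1 / c * 3)"
      using \<open>c > 0\<close> by (subst ennreal_mult') auto
    then show ?thesis by (simp add: mult.assoc[symmetric])
  qed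
  finally show ?thesis by (simp add: mult_left_mono)
qed

text \<open>The blocks cover the half-line, so the supremum can be taken block by block.\<close>

lemma fock_norm_infinity:
  "fock_norm \<alpha> p \<infinity> f = (SUP k. block_sup \<alpha> p f k)"
proof -
  have "{0::real..} = (\<Union>k. {real k..<real k + 1})"
  proof (intro set_eqI iffI)
    fix r :: real assume "r \<in> {0..}"
    then have "r \<in> {real (nat \<lfloor>r\<rfloor>)..<real (nat \<lfloor>r\<rfloor>) + 1}" by auto
    then show "r \<in> (\<Union>k. {real k..<real k + 1})" by blast
  qed (auto intro: order_trans[OF of_nat_0_le_iff])
  then show ?thesis
    by (simp add: fock_norm_def block_sup_def SUP_UNION)
qed

theorem proposition2p6:
  fixes \<alpha> :: real
  assumes "\<alpha> > 0"
  shows "(\<forall>q::real. q > 0 \<longrightarrow>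
            (\<exists>C::real. C > 0 \<and>
              (\<forall>(p::ennreal) f. p > 0 \<longrightarrow> f holomorphic_on UNIV \<longrightarrow>
                 ennreal (1 / C) * (\<Sum>k. of_nat (1 + k) * epowr (block_sup \<alpha> p f k) q)
                   \<le> epowr (fock_norm \<alpha> p (ennreal q) f) q \<and>
                 epowr (fock_norm \<alpha> p (ennreal q) f) q
                   \<le> ennreal C * (\<Sum>k. of_nat (1 + k) * epowr (block_sup \<alpha> p f k) q)))) \<and>
         (\<forall>(p::ennreal) f. p > 0 \<longrightarrow> f holomorphic_on UNIV \<longrightarrow>
            fock_norm \<alpha> p \<infinity> f = (SUP k. block_sup \<alpha> p f k))"
proof (intro conjI allI impI)
  fix q :: real assume "q > 0"
  \<comment> \<open>\<open>c\<close> is the constant of \<open>block_sum_le_fock_integral\<close>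
    and \<open>C\<close> covers both directions. Neither mentions \<open>p\<close> or
    \<open>f\<close>, so \<open>C\<close> can be chosen before them.\<close>
  define c where "c = \<alpha> * q * exp (- 9 * \<alpha> * q / 8) / 8"
  define C where "C = max (\<alpha> * q) (3 / c)"
  have c: "c > 0" using assms \<open>q > 0\<close> by (simp add: c_def)
  have C: "C > 0" "\<alpha> * q \<le> C" "3 / c \<le> C"
    using assms \<open>q > 0\<close> by (auto simp: C_def less_max_iff_disj)
  show "\<exists>C::real. C > 0 \<and>
      (\<forall>(p::ennreal) f. p > 0 \<longrightarrow> f holomorphic_on UNIV \<longrightarrow>
         ennreal (1 / C) * (\<Sum>k. of_nat (1 + k) * epowr (block_sup \<alpha> p f k) q)
           \<le> epowr (fock_norm \<alpha> p (ennreal q) f) q \<and>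
         epowr (fock_norm \<alpha> p (ennreal q) f) q
           \<le> ennreal C * (\<Sum>k. of_nat (1 + k) * epowr (block_sup \<alpha> p f k) q))"
  proof (intro exI[of _ C] conjI allI impI C(1))
    fix p :: ennreal and f :: "complex \<Rightarrow> complex"
    assume pf: "p > 0" "f holomorphic_on UNIV"
    let ?S = "\<Sum>k. of_nat (1 + k) * epowr (block_sup \<alpha> p f k) q"
    let ?N = "epowr (fock_norm \<alpha> p (ennreal q) f) q"
    note N = epowr_fock_norm[OF \<open>q > 0\<close>, of \<alpha> p f]
    have "?S \<le> ennreal (3 / c) * ?N"
      unfolding N c_def using block_sum_le_fock_integral[OF assms \<open>q > 0\<close> pf(2,1)] .
    also have "\<dots> \<le> ennreal C * ?N"
      using C by (intro mult_right_mono ennreal_leI) auto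
    finally have "ennreal (1 / C) * ?S \<le> ennreal (1 / C) * (ennreal C * ?N)"
      by (intro mult_left_mono) auto
    also have "\<dots> = ennreal (1 / C * C) * ?N"
      using C(1) by (subst ennreal_mult') (auto simp: mult.assoc)
    finally show "ennreal (1 / C) * ?S \<le> ?N"
      using C(1) by simp
    have "?N \<le> ennreal (\<alpha> * q) * ?S"
      unfolding N using fock_integral_le_block_sum[OF assms \<open>q > 0\<close> pf(2,1)] .
    also have "\<dots> \<le> ennreal C * ?S"
      using C by (intro mult_right_mono ennreal_leI) auto
    finally show "?N \<le> ennreal C * ?S" .
  qed
qed (rule fock_norm_infinity)

end
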